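(* Let $V=V_0+V_1$ be a Lie superalgebra over a field $K$, and let $A=(\lambda_A,\rho_A)$ be a CIF set of $V$ with $\lambda_A(0)=1$ and $\rho_A(0)=0$. If all non-empty level sets $U(\lambda_A,(t,s))$ and $L(\rho_A,(t,s))$, $t,s\in[0,1]$, are Lie sub-superalgebras (respectively ideals) of $V$, then $A$ is a CIF Lie sub-superalgebra (respectively CIF ideal) of $V$.
   Context: Complex numbers in the closed unit disk are written $\alpha e^{i2\pi\beta}$ with $\alpha,\beta\in[0,1]$ and are handled through the pair $(\alpha,\beta)$: $\alpha e^{i2\pi\beta}\le\gamma e^{i2\pi\delta}$ means $\alpha\le\gamma$ and $\beta\le\delta$. The symbols $\wedge$ (min), $\vee$ (max), $\sup$, $\inf$ are taken componentwise on such pairs. The value $1$ stands for $1e^{i2\pi\cdot 1}$ and $0$ for $0e^{i2\pi\cdot 0}$. A complex intuitionistic fuzzy (CIF) set on a nonempty set $X$ is a pair $A=(\lambda_A,\rho_A)$ of functions $\lambda_A(x)=r_A(x)e^{i2\pi\omega_A(x)}$, $\rho_A(x)=\hat r_A(x)e^{i2\pi\hat\omega_A(x)}$ with $r_A,\omega_A,\hat r_A,\hat\omega_A:X\to[0,1]$ and $r_A(x)+\hat r_A(x)\le 1$ for all $x$. A CIF set $A$ on a $K$-vector space $V$ is a CIF vector subspace of $V$ if for all $x,y\in V$, $\alpha\in K$: $\lambda_A(x+y)\ge\lambda_A(x)\wedge\lambda_A(y)$, $\rho_A(x+y)\le\rho_A(x)\vee\rho_A(y)$, $\lambda_A(\alpha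 x)\ge\lambda_A(x)$, $\rho_A(\alpha x)\le\rho_A(x)$; moreover it is always assumed that $\lambda_A(0)=1$ and $\rho_A(0)=0$. A Lie superalgebra over $K$ is a $\mathbb{Z}_2$-graded vector space $V=V_0+V_1$ (direct sum) with a bilinear bracket $[\,,]:V\times V\to V$ such that $[V_i,V_j]\subseteq V_{i+j}$; $[x,y]=-(-1)^{|x||y|}[y,x]$; and $[x,[y,z]]-(-1)^{|x||y|}[y,[x,z]]=[[x,y],z]$ for homogeneous elements. A Lie sub-superalgebra (respectively ideal) of $V$ is a $\mathbb{Z}_2$-graded subspace $W=(W\cap V_0)+(W\cap V_1)$ with $[x,y]\in W$ whenever $x,y\in W$ (respectively whenever $x\in W$ or $y\in W$). Given CIF vector subspaces $A_j$ of $V_j$ ($j=0,1$), let $\mathfrak a_j$ be the extension of $A_j$ to $V$: $\lambda_{\mathfrak a_j}=\lambda_{A_j}$, $\rho_{\mathfrak a_j}=\rho_{A_j}$ on $V_j$, and $\lambda_{\mathfrak a_j}=0$, $\rho_{\mathfrak a_j}=1$ off $V_j$. Then $A_0\oplus A_1$ denotes the CIF set $\mathfrak a_0+\mathfrak a_1$ on $V$ given by $\lambda(x)=\sup_{x=a+b}\{\lambda_{\mathfrak a_0}(a)\wedge\lambda_{\mathfrak a_1}(b)\}$, $\rho(x)=\inf_{x=a+b}\{\rho_{\mathfrak a_0}(a)\vee\rho_{\mathfrak a_1}(b)\}$. A CIF vector subspace $A$ of $V$ is $\mathbb{Z}_2$-graded if $A=A_0\oplus A_1$ for some such $A_0,A_1$.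 A CIF set $A$ of $V$ is a CIF Lie sub-superalgebra if it is a $\mathbb{Z}_2$-graded CIF vector subspace and $\lambda_A([x,y])\ge\lambda_A(x)\wedge\lambda_A(y)$, $\rho_A([x,y])\le\rho_A(x)\vee\rho_A(y)$ for all $x,y\in V$. It is a CIF ideal if it is a $\mathbb{Z}_2$-graded CIF vector subspace and $\lambda_A([x,y])\ge\lambda_A(x)\vee\lambda_A(y)$, $\rho_A([x,y])\le\rho_A(x)\wedge\rho_A(y)$ for all $x,y\in V$. For a function $\lambda=re^{i2\pi\omega}$ on $V$ with $r,\omega:V\to[0,1]$ and $t,s\in[0,1]$: $U(\lambda,(t,s))=\{x\in V: r(x)\ge t\text{ and }\omega(x)\ge s\}$, $L(\lambda,(t,s))=\{x\in V: r(x)\le t\text{ and }\omega(x)\le s\}$. *)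

theory Defs
  imports Complex_Main "HOL-Library.Product_Order" "HOL-Library.Z2"
begin

text \<open>
  A complex number \<open>\<alpha> e\<^sup>i\<^sup>2\<^sup>\<pi>\<^sup>\<beta>\<close> of the closed unit disk is represented by its pair
  \<open>(\<alpha>, \<beta>)\<close> of coordinates in \<open>[0,1]\<close>, as the theory only ever handles these numbers through
  that pair (the map from pairs to complex numbers is not injective, so the pair cannot be recovered
  from the number). The order \<open>\<le>\<close>, \<open>inf\<close>, \<open>sup\<close>, \<open>Inf\<close>, \<open>Sup\<close> on \<^typ>\<open>real \<times> real\<close> are the
  componentwise ones of \<^theory>\<open>HOL-Library.Product_Order\<close>; the value \<open>1\<close> is \<open>(1, 1)\<close> and the
  value \<open>0\<close> is \<open>(0, 0)\<close>.
\<close>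

type_synonym 'v cfun = "'v \<Rightarrow> real \<times> real"

type_synonym 'v cif = "'v cfun \<times> 'v cfun"

abbreviation mem :: "'v cif \<Rightarrow> 'v cfun" where
  "mem A \<equiv> fst A"

abbreviation nonmem :: "'v cif \<Rightarrow> 'v cfun" where
  "nonmem A \<equiv> snd A"

text \<open>The sum condition concerns the amplitudes only, not the phases. Values off \<open>X\<close> are
  irrelevant.\<close>

definition cif_set :: "'v set \<Rightarrow> 'v cif \<Rightarrow> bool" where
  "cif_set X A \<longleftrightarrow> X \<noteq> {} \<and>
     (\<forall>x\<in>X. mem A x \<in> {(0, 0)..(1, 1)} \<and> nonmem A x \<in> {(0, 0)..(1, 1)} \<and>
        fst (mem A x) + fst (nonmem A x) \<le> 1)"

text \<open>\<open>W\<close> is the underlying vector space, given as a linear subspace of the ambient type.\<close>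

definition cif_vector_subspace ::
    "('k::field \<Rightarrow> 'v::ab_group_add \<Rightarrow> 'v) \<Rightarrow> 'v set \<Rightarrow> 'v cif \<Rightarrow> bool" where
  "cif_vector_subspace scale W A \<longleftrightarrow>
     cif_set W A \<and> mem A 0 = (1, 1) \<and> nonmem A 0 = (0, 0) \<and>
     (\<forall>x\<in>W. \<forall>y\<in>W. mem A (x + y) \<ge> inf (mem A x) (mem A y) \<and>
        nonmem A (x + y) \<le> sup (nonmem A x) (nonmem A y)) \<and>
     (\<forall>a. \<forall>x\<in>W. mem A (scale a x) \<ge> mem A x \<and> nonmem A (scale a x) \<le> nonmem A x)"

text \<open>The grading is indexed by the field \<^typ>\<open>bit\<close> of integers modulo 2, so \<open>i + j\<close> is addition
  modulo 2; \<^term>\<open>of_bit i\<close> is the corresponding natural number in \<open>{0, 1}\<close>.\<close>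

locale lie_superalgebra = vector_space scale
  for scale :: "'k::field \<Rightarrow> 'v::ab_group_add \<Rightarrow> 'v" +
  fixes V :: "bit \<Rightarrow> 'v set"
    and br :: "'v \<Rightarrow> 'v \<Rightarrow> 'v"
  assumes subspace_V: "subspace (V i)"
    and V_sum: "{a + b | a b. a \<in> V 0 \<and> b \<in> V 1} = UNIV"
    and V_direct: "V 0 \<inter> V 1 = {0}"
    and linear_left: "Vector_Spaces.linear scale scale (\<lambda>x. br x y)"
    and linear_right: "Vector_Spaces.linear scale scale (\<lambda>y. br x y)"
    and br_graded: "x \<in> V i \<Longrightarrow> y \<in> V j \<Longrightarrow> br x y \<in> V (i + j)"
    and super_skew: "x \<in> V i \<Longrightarrow> y \<in> V j \<Longrightarrow>
      br x y = - scale ((-1) ^ (of_bit i * of_bit j)) (br y x)"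
    and super_jacobi: "x \<in> V i \<Longrightarrow> y \<in> V j \<Longrightarrow> z \<in> V k \<Longrightarrow>
      br x (br y z) - scale ((-1) ^ (of_bit i * of_bit j)) (br y (br x z)) = br (br x y) z"

definition graded_subspace ::
    "('k::field \<Rightarrow> 'v::ab_group_add \<Rightarrow> 'v) \<Rightarrow> (bit \<Rightarrow> 'v set) \<Rightarrow> 'v set \<Rightarrow> bool" where
  "graded_subspace scale V W \<longleftrightarrow>
     module.subspace scale W \<and> W = {a + b | a b. a \<in> W \<inter> V 0 \<and> b \<in> W \<inter> V 1}"

definition lie_sub_superalgebra ::
    "('k::field \<Rightarrow> 'v::ab_group_add \<Rightarrow> 'v) \<Rightarrow> (bit \<Rightarrow> 'v set) \<Rightarrow> ('v \<Rightarrow> 'v \<Rightarrow> 'v) \<Rightarrow> 'v set \<Rightarrow> bool"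
  where
  "lie_sub_superalgebra scale V br W \<longleftrightarrow>
     graded_subspace scale V W \<and> (\<forall>x y. x \<in> W \<and> y \<in> W \<longrightarrow> br x y \<in> W)"

definition lie_ideal ::
    "('k::field \<Rightarrow> 'v::ab_group_add \<Rightarrow> 'v) \<Rightarrow> (bit \<Rightarrow> 'v set) \<Rightarrow> ('v \<Rightarrow> 'v \<Rightarrow> 'v) \<Rightarrow> 'v set \<Rightarrow> bool"
  where
  "lie_ideal scale V br W \<longleftrightarrow>
     graded_subspace scale V W \<and> (\<forall>x y. x \<in> W \<or> y \<in> W \<longrightarrow> br x y \<in> W)"

definition cif_extension :: "'v set \<Rightarrow> 'v cif \<Rightarrow> 'v cif" where
  "cif_extension W A =
     ((\<lambda>x. if x \<in> W then mem A x else (0, 0)), (\<lambda>x. if x \<in> W then nonmem A x else (1, 1)))"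

definition cif_sum :: "'v::ab_group_add cif \<Rightarrow> 'v cif \<Rightarrow> 'v cif" where
  "cif_sum A B =
     ((\<lambda>x. Sup {inf (mem A a) (mem B b) | a b. x = a + b}),
      (\<lambda>x. Inf {sup (nonmem A a) (nonmem B b) | a b. x = a + b}))"

definition graded_cif_vector_subspace ::
    "('k::field \<Rightarrow> 'v::ab_group_add \<Rightarrow> 'v) \<Rightarrow> (bit \<Rightarrow> 'v set) \<Rightarrow> 'v cif \<Rightarrow> bool" where
  "graded_cif_vector_subspace scale V A \<longleftrightarrow>
     cif_vector_subspace scale UNIV A \<and>
     (\<exists>A0 A1. cif_vector_subspace scale (V 0) A0 \<and> cif_vector_subspace scale (V 1) A1 \<and>
        A = cif_sum (cif_extension (V 0) A0) (cif_extension (V 1) A1))"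

definition cif_lie_sub_superalgebra ::
    "('k::field \<Rightarrow> 'v::ab_group_add \<Rightarrow> 'v) \<Rightarrow> (bit \<Rightarrow> 'v set) \<Rightarrow> ('v \<Rightarrow> 'v \<Rightarrow> 'v) \<Rightarrow> 'v cif \<Rightarrow> bool"
  where
  "cif_lie_sub_superalgebra scale V br A \<longleftrightarrow>
     cif_set UNIV A \<and> graded_cif_vector_subspace scale V A \<and>
     (\<forall>x y. mem A (br x y) \<ge> inf (mem A x) (mem A y) \<and>
        nonmem A (br x y) \<le> sup (nonmem A x) (nonmem A y))"

definition cif_ideal ::
    "('k::field \<Rightarrow> 'v::ab_group_add \<Rightarrow> 'v) \<Rightarrow> (bit \<Rightarrow> 'v set) \<Rightarrow> ('v \<Rightarrow> 'v \<Rightarrow> 'v) \<Rightarrow> 'v cif \<Rightarrow> bool"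
  where
  "cif_ideal scale V br A \<longleftrightarrow>
     cif_set UNIV A \<and> graded_cif_vector_subspace scale V A \<and>
     (\<forall>x y. mem A (br x y) \<ge> sup (mem A x) (mem A y) \<and>
        nonmem A (br x y) \<le> inf (nonmem A x) (nonmem A y))"

definition upper_level :: "'v cfun \<Rightarrow> real \<times> real \<Rightarrow> 'v set" where
  "upper_level l p = {x. fst (l x) \<ge> fst p \<and> snd (l x) \<ge> snd p}"

definition lower_level :: "'v cfun \<Rightarrow> real \<times> real \<Rightarrow> 'v set" where
  "lower_level l p = {x. fst (l x) \<le> fst p \<and> snd (l x) \<le> snd p}"

end

theory Submission
  imports Defs
begin

text \<open>
  A point \<open>x\<close> lies in the level set cut out by its own value, and \<open>x, y\<close> both lie in the one cut
  out by the meet (join) of their values, so closure properties of level sets are inequalities for the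
  values. In particular, if \<open>x = a + b\<close> is the homogeneous decomposition, gradedness of the level set
  of \<open>x\<close> together with uniqueness of \<open>a, b\<close> shows that the value at \<open>x\<close> is exactly the meet (join)
  of the values at \<open>a\<close> and \<open>b\<close>; hence \<open>A\<close> is the sum of its own restrictions to \<open>V\<^sub>0\<close> and \<open>V\<^sub>1\<close>.
\<close>

lemma mem_upper_level_iff [simp]: "x \<in> upper_level l p \<longleftrightarrow> p \<le> l x"
  by (simp add: upper_level_def less_eq_prod_def)

lemma mem_lower_level_iff [simp]: "x \<in> lower_level l p \<longleftrightarrow> l x \<le> p"
  by (simp add: lower_level_def less_eq_prod_def)

text \<open>\<open>Sup\<close> on pairs is formed coordinate by coordinate, and a greatest element
  of \<open>S\<close> projects to a greatest element of both images.\<close>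

lemma Sup_prod_eq_maximum:
  fixes m :: "'a::conditionally_complete_lattice \<times> 'b::conditionally_complete_lattice"
  assumes "m \<in> S" "\<And>z. z \<in> S \<Longrightarrow> z \<le> m"
  shows "Sup S = m"
proof -
  have "Sup (fst ` S) = fst m" "Sup (snd ` S) = snd m"
    using assms by (auto intro!: cSup_eq_maximum simp: less_eq_prod_def)
  then show ?thesis
    by (simp add: Sup_prod_def)
qed

lemma Inf_prod_eq_minimum:
  fixes m :: "'a::conditionally_complete_lattice \<times> 'b::conditionally_complete_lattice"
  assumes "m \<in> S" "\<And>z. z \<in> S \<Longrightarrow> m \<le> z"
  shows "Inf S = m"
proof -
  have "Inf (fst ` S) = fst m" "Inf (snd ` S) = snd m"
    using assms by (auto intro!: cInf_eq_minimum simp: less_eq_prod_def)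
  then show ?thesis
    by (simp add: Inf_prod_def)
qed

context lie_superalgebra
begin

lemma homogeneous_decomposition:
  obtains a b where "a \<in> V 0" "b \<in> V 1" "x = a + b"
  using V_sum by blast

lemma homogeneous_decomposition_unique:
  assumes "a \<in> V 0" "b \<in> V 1" "a' \<in> V 0" "b' \<in> V 1" "a + b = a' + b'"
  shows "a' = a" "b' = b"
proof -
  have "a' - a = b - b'"
    using assms(5) by (simp add: algebra_simps)
  moreover have "a' - a \<in> V 0" "b - b' \<in> V 1"
    using assms subspace_V subspace_diff by blast+
  ultimately have "a' - a \<in> V 0 \<inter> V 1"
    by simp
  then show "a' = a"
    using V_direct by simp
  then show "b' = b"
    using assms(5) by simp
qed

text \<open>Gradedness supplies some homogeneous summands inside \<open>W\<close>; by directness of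
  the sum they can only be the given \<open>a\<close> and \<open>b\<close>.\<close>

lemma graded_subspace_components:
  assumes "graded_subspace scale V W" "a \<in> V 0" "b \<in> V 1" "a + b \<in> W"
  shows "a \<in> W" "b \<in> W"
proof -
  have "a + b \<in> {a + b | a b. a \<in> W \<inter> V 0 \<and> b \<in> W \<inter> V 1}"
    using assms(1,4) unfolding graded_subspace_def by blast
  then obtain a' b' where "a' \<in> W \<inter> V 0" "b' \<in> W \<inter> V 1" "a + b = a' + b'"
    by blast
  then show "a \<in> W" "b \<in> W"
    using homogeneous_decomposition_unique[of a b a' b'] assms(2,3) by auto
qed

text \<open>The part shared by the sub-superalgebra and ideal cases. Two points \<open>x\<close>,
  \<open>y\<close> index the levels so that sums can be treated; \<open>y = x\<close> gives the
  level of a single value.\<close>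

lemma graded_cif_vector_subspace_if_levels:
  assumes A: "cif_set UNIV A" "mem A 0 = (1, 1)" "nonmem A 0 = (0, 0)"
    and upper: "\<And>x y. graded_subspace scale V (upper_level (mem A) (inf (mem A x) (mem A y)))"
    and lower: "\<And>x y. graded_subspace scale V (lower_level (nonmem A) (sup (nonmem A x) (nonmem A y)))"
  shows "graded_cif_vector_subspace scale V A"
proof -
  have bounds: "(0, 0) \<le> mem A x" "nonmem A x \<le> (1, 1)" for x
    using A(1) by (auto simp: cif_set_def)
  have subspaces: "subspace (upper_level (mem A) (inf (mem A x) (mem A y)))"
    "subspace (lower_level (nonmem A) (sup (nonmem A x) (nonmem A y)))" for x y
    using upper lower unfolding graded_subspace_def by blast+
  have add: "inf (mem A x) (mem A y) \<le> mem A (x + y)"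
    "nonmem A (x + y) \<le> sup (nonmem A x) (nonmem A y)" for x y
    using subspace_add[OF subspaces(1)[of x y], of x y]
      subspace_add[OF subspaces(2)[of x y], of x y] by simp_all
  have smult: "mem A x \<le> mem A (scale c x)" "nonmem A (scale c x) \<le> nonmem A x" for c x
    using subspace_scale[OF subspaces(1)[of x x], of x c]
      subspace_scale[OF subspaces(2)[of x x], of x c] by simp_all
  \<comment> \<open>The inequalities hold on the whole space, so they pass to any nonempty
    \<open>W\<close>. This covers \<open>UNIV\<close> and both \<open>V i\<close>, so
    \<open>A\<close> itself can serve as \<open>A0\<close> and \<open>A1\<close>: the extension
    discards its values off \<open>V i\<close>.\<close>
  have restrict: "cif_vector_subspace scale W A" if "W \<noteq> {}" for W
    using that A add smult by (auto simp: cif_vector_subspace_def cif_set_def)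
  define B0 where "B0 = cif_extension (V 0) A"
  define B1 where "B1 = cif_extension (V 1) A"
  \<comment> \<open>If a summand is not in its homogeneous part, the default \<open>(0, 0)\<close>
    pushes the meet below every value of \<open>mem A\<close>; otherwise this is \<open>add\<close>.
    Dually for \<open>nonmem\<close> with the default \<open>(1, 1)\<close>.\<close>
  have mem_le: "inf (mem B0 a) (mem B1 b) \<le> mem A (a + b)" for a b
    using add(1)[of a b] bounds(1)[of "a + b"]
    by (auto simp: B0_def B1_def cif_extension_def intro: le_infI1 le_infI2)
  have nonmem_ge: "nonmem A (a + b) \<le> sup (nonmem B0 a) (nonmem B1 b)" for a b
    using add(2)[of a b] bounds(2)[of "a + b"]
    by (auto simp: B0_def B1_def cif_extension_def intro: le_supI1 le_supI2)
  \<comment> \<open>Attainment makes the supremum a maximum and the infimum a minimum; the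
    homogeneous decomposition of \<open>x\<close> is the witness.\<close>
  have attained: "mem A x \<in> {inf (mem B0 a) (mem B1 b) | a b. x = a + b}"
    "nonmem A x \<in> {sup (nonmem B0 a) (nonmem B1 b) | a b. x = a + b}" for x
  proof -
    obtain a b where ab: "a \<in> V 0" "b \<in> V 1" and x: "x = a + b"
      by (rule homogeneous_decomposition)
    have "mem A x \<le> mem A a" "mem A x \<le> mem A b"
      using graded_subspace_components[OF upper[of x x] ab] x by simp_all
    moreover have "nonmem A a \<le> nonmem A x" "nonmem A b \<le> nonmem A x"
      using graded_subspace_components[OF lower[of x x] ab] x by simp_all
    ultimately have "mem A x = inf (mem B0 a) (mem B1 b)"
      "nonmem A x = sup (nonmem B0 a) (nonmem B1 b)"
      using ab x add[of a b] by (auto simp: B0_def B1_def cif_extension_def intro!: antisym)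
    then show "mem A x \<in> {inf (mem B0 a) (mem B1 b) | a b. x = a + b}"
      "nonmem A x \<in> {sup (nonmem B0 a) (nonmem B1 b) | a b. x = a + b}"
      using x by blast+
  qed
  have "mem (cif_sum B0 B1) = mem A"
    unfolding cif_sum_def fst_conv
    by (intro ext Sup_prod_eq_maximum attained) (use mem_le in auto)
  moreover have "nonmem (cif_sum B0 B1) = nonmem A"
    unfolding cif_sum_def snd_conv
    by (intro ext Inf_prod_eq_minimum attained) (use nonmem_ge in auto)
  ultimately have "A = cif_sum B0 B1"
    by (simp add: prod_eq_iff)
  moreover have "V i \<noteq> {}" for i
    using subspace_0[OF subspace_V] by blast
  ultimately show ?thesis
    using restrict unfolding graded_cif_vector_subspace_def B0_def B1_def by blast
qed

end

text \<open>The predicate \<open>P\<close> is left abstract to serve both cases. Meets and joins of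
  values stay in the unit square, and the levels they cut out contain \<open>x\<close>, hence are
  nonempty.\<close>

lemma level_property:
  assumes A: "cif_set UNIV A"
    and levels: "\<forall>t\<in>{0..1}. \<forall>s\<in>{0..1}.
      (upper_level (mem A) (t, s) \<noteq> {} \<longrightarrow> P (upper_level (mem A) (t, s))) \<and>
      (lower_level (nonmem A) (t, s) \<noteq> {} \<longrightarrow> P (lower_level (nonmem A) (t, s)))"
  shows "P (upper_level (mem A) (inf (mem A x) (mem A y)))"
    and "P (lower_level (nonmem A) (sup (nonmem A x) (nonmem A y)))"
proof -
  have range: "mem A z \<in> {(0, 0)..(1, 1)}" "nonmem A z \<in> {(0, 0)..(1, 1)}" for z
    using A by (auto simp: cif_set_def)
  have "inf (mem A x) (mem A y) \<in> {(0, 0)..(1, 1)}"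
    "sup (nonmem A x) (nonmem A y) \<in> {(0, 0)..(1, 1)}"
    using range[of x] range[of y] by (auto intro: le_infI1 le_supI1)
  moreover have "x \<in> upper_level (mem A) (inf (mem A x) (mem A y))"
    "x \<in> lower_level (nonmem A) (sup (nonmem A x) (nonmem A y))"
    by simp_all
  moreover have "P (upper_level (mem A) p)"
    if "p \<in> {(0, 0)..(1, 1)}" "upper_level (mem A) p \<noteq> {}" for p
    using that levels by (cases p) auto
  moreover have "P (lower_level (nonmem A) p)"
    if "p \<in> {(0, 0)..(1, 1)}" "lower_level (nonmem A) p \<noteq> {}" for p
    using that levels by (cases p) auto
  ultimately show "P (upper_level (mem A) (inf (mem A x) (mem A y)))"
    "P (lower_level (nonmem A) (sup (nonmem A x) (nonmem A y)))"
    by blast+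
qed

theorem theorem3p10:
  fixes scale :: "'k::field \<Rightarrow> 'v::ab_group_add \<Rightarrow> 'v"
    and V :: "bit \<Rightarrow> 'v set"
    and br :: "'v \<Rightarrow> 'v \<Rightarrow> 'v"
    and A :: "'v cif"
  assumes "lie_superalgebra scale V br"
    and "cif_set UNIV A"
    and "mem A 0 = (1, 1)"
    and "nonmem A 0 = (0, 0)"
  shows "((\<forall>t\<in>{0..1}. \<forall>s\<in>{0..1}.
             (upper_level (mem A) (t, s) \<noteq> {} \<longrightarrow>
                lie_sub_superalgebra scale V br (upper_level (mem A) (t, s))) \<and>
             (lower_level (nonmem A) (t, s) \<noteq> {} \<longrightarrow>
                lie_sub_superalgebra scale V br (lower_level (nonmem A) (t, s))))
           \<longrightarrow> cif_lie_sub_superalgebra scale V br A) \<and>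
         ((\<forall>t\<in>{0..1}. \<forall>s\<in>{0..1}.
             (upper_level (mem A) (t, s) \<noteq> {} \<longrightarrow>
                lie_ideal scale V br (upper_level (mem A) (t, s))) \<and>
             (lower_level (nonmem A) (t, s) \<noteq> {} \<longrightarrow>
                lie_ideal scale V br (lower_level (nonmem A) (t, s))))
           \<longrightarrow> cif_ideal scale V br A)"
proof (intro conjI impI, goal_cases)
  case 1
  note levels = level_property[OF assms(2) 1]
  have "graded_cif_vector_subspace scale V A"
    using lie_superalgebra.graded_cif_vector_subspace_if_levels[OF assms] levels
    by (simp add: lie_sub_superalgebra_def)
  moreover have "br x y \<in> upper_level (mem A) (inf (mem A x) (mem A y))"
    "br x y \<in> lower_level (nonmem A) (sup (nonmem A x) (nonmem A y))" for x y
    using levels[of x y] by (simp_all add: lie_sub_superalgebra_def)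
  ultimately show ?case
    using assms(2) by (simp add: cif_lie_sub_superalgebra_def)
next
  case 2
  note levels = level_property[OF assms(2) 2]
  have "graded_cif_vector_subspace scale V A"
    using lie_superalgebra.graded_cif_vector_subspace_if_levels[OF assms] levels
    by (simp add: lie_ideal_def)
  \<comment> \<open>An ideal absorbs brackets with one factor in it, so the levels of
    \<open>x\<close> and of \<open>y\<close> are used separately; the two bounds combine to the join
    for \<open>mem\<close> and the meet for \<open>nonmem\<close>.\<close>
  moreover have "br x y \<in> upper_level (mem A) (mem A x)" "br x y \<in> upper_level (mem A) (mem A y)"
    "br x y \<in> lower_level (nonmem A) (nonmem A x)" "br x y \<in> lower_level (nonmem A) (nonmem A y)"
    for x y
    using levels[of x x] levels[of y y] by (simp_all add: lie_ideal_def)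
  ultimately show ?case
    using assms(2) by (simp add: cif_ideal_def)
qed

end
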